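(* Let $0\le k<n$ be integers and let $A,B\subseteq\mathbb{R}^n$ be bounded sets such that $\dim_B(A)=n$ and such that $B$ contains the $k$-skeleton of an $n$-cube around every point of $A$ (that is, for every $x\in A$ there is $r>0$ with $S_k(x,r)\subseteq B$). Then \[ \underline{\dim}_B(B)\ \ge\ n-\frac12+\frac{k}{2n}. \]
   Context: For $x\in\mathbb{R}^n$ and $r>0$, $S_k(x,r)$ denotes the $k$-skeleton of the axes-parallel $n$-cube $x+[-r,r]^n$: $S_k(x,r)=x+\bigcup_{I}\prod_{i=1}^n A_{I,i}$, where $I$ ranges over the $k$-element subsets of $\{1,\dots,n\}$, $A_{I,i}=[-r,r]$ if $i\in I$ and $A_{I,i}=\{-r,r\}$ otherwise. All $n$-cubes have sides parallel to the axes. $\dim_B$ denotes box-counting (Minkowski) dimension (so $\dim_B(A)=n$ means that the lower and upper box dimensions of $A$ both equal $n$), and $\underline{\dim}_B$ denotes lower box-counting dimension. *)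

theory Defs
  imports "HOL-Analysis.Analysis"
begin

text \<open>The least number of sets of diameter at most \<open>\<delta>\<close> that cover \<open>A\<close>. Boundedness of the
  covering sets is required explicitly because \<^const>\<open>diameter\<close> is unspecified on unbounded
  sets. The number is meaningful only if a finite cover exists, in particular for bounded subsets
  of a Euclidean space and \<open>\<delta> > 0\<close>.\<close>

definition covering_number :: "real \<Rightarrow> 'a::metric_space set \<Rightarrow> nat" where
  "covering_number \<delta> A =
     (LEAST m. \<exists>\<U>. finite \<U> \<and> card \<U> = m \<and> A \<subseteq> \<Union>\<U> \<and>
                   (\<forall>U\<in>\<U>. bounded U \<and> diameter U \<le> \<delta>))"

text \<open>Since \<open>ln 0 = 0\<close> in HOL, the empty set gets dimension \<open>0\<close> here.\<close>

definition lower_box_dim :: "'a::metric_space set \<Rightarrow> ereal" where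
  "lower_box_dim A =
     Liminf (at_right 0) (\<lambda>\<delta>. ereal (ln (real (covering_number \<delta> A)) / - ln \<delta>))"

definition upper_box_dim :: "'a::metric_space set \<Rightarrow> ereal" where
  "upper_box_dim A =
     Limsup (at_right 0) (\<lambda>\<delta>. ereal (ln (real (covering_number \<delta> A)) / - ln \<delta>))"

definition has_box_dim :: "'a::metric_space set \<Rightarrow> ereal \<Rightarrow> bool" where
  "has_box_dim A d \<longleftrightarrow> lower_box_dim A = d \<and> upper_box_dim A = d"

definition skeleton :: "nat \<Rightarrow> real ^ 'n \<Rightarrow> real \<Rightarrow> (real ^ 'n) set" where
  "skeleton k x r =
     (+) x ` (\<Union>I\<in>{I. card I = k}. {y. \<forall>i. y $ i \<in> (if i \<in> I then {-r..r} else {-r, r})})"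

end

theory Submission
  imports Defs "HOL-Real_Asymp.Real_Asymp"
begin

text \<open>Discretise at scale \<open>\<delta>\<close>, and consider the centres in a grid cube of side \<open>R\<close> whose cubes
  have radius between \<open>R\<close> and \<open>2R\<close>. Along a line of direction \<open>(1, \<dots>, 1)\<close> every centre is the
  midpoint of two vertices, so the set \<open>V\<close> of vertices satisfies \<open>|A| \<le> R\<^sup>1\<^sup>/\<^sup>2 |V|\<close>. Each
  vertex spans, in any \<open>k\<close> coordinate directions \<open>I\<close>, a face of its cube which crosses the whole
  grid cube; so \<open>B\<close> contains \<open>R\<^sup>k\<close> points over every point of the projection of \<open>V\<close> along
  \<open>I\<close>. Shearer's inequality over all \<open>I\<close> bounds \<open>|V|\<close> by these projections, and with
  \<open>|A| \<le> R\<^sup>n\<close> this gives \<open>|A| \<le> R\<^sup>\<theta> |B|\<close> near the grid cube, where \<open>\<theta> = (n - k) / (2n)\<close>.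
  Summing over grid cubes and dyadic \<open>R \<lesssim> 1 / \<delta>\<close> loses only a constant.\<close>

section \<open>Shearer's inequality\<close>

text \<open>This is Hoelder's inequality for \<open>card D\<close> factors with equal exponents,
  kept in power form. Each \<open>c j\<close> is normalised to total mass 1, AM-GM is applied for
  every \<open>t\<close>, and the results are summed.\<close>

lemma Hoelder_sum_prod:
  fixes s :: "'t \<Rightarrow> real" and c :: "'j \<Rightarrow> 't \<Rightarrow> real"
  assumes T: "finite T" and D: "finite D" "D \<noteq> {}" and K: "0 \<le> K"
    and s: "\<And>t. t \<in> T \<Longrightarrow> 0 \<le> s t"
    and c: "\<And>j t. j \<in> D \<Longrightarrow> t \<in> T \<Longrightarrow> 0 \<le> c j t"
    and le: "\<And>t. t \<in> T \<Longrightarrow> s t ^ card D \<le> K * (\<Prod>j\<in>D. c j t)"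
  shows "(\<Sum>t\<in>T. s t) ^ card D \<le> K * (\<Prod>j\<in>D. \<Sum>t\<in>T. c j t)"
proof -
  define d where "d = card D"
  have d: "d > 0" using D by (simp add: d_def card_gt_0_iff)
  define S where "S j = (\<Sum>t\<in>T. c j t)" for j
  have S0: "S j \<ge> 0" if "j \<in> D" for j
    unfolding S_def using c that by (intro sum_nonneg) auto
  show ?thesis
  \<comment> \<open>A vanishing total cannot be normalised; it forces every \<open>s t\<close> to be
    0.\<close>
  proof (cases "\<exists>j\<in>D. S j = 0")
    case True
    then obtain j where j: "j \<in> D" "S j = 0" by blast
    have "c j t = 0" if "t \<in> T" for t
      using j that c T sum_nonneg_eq_0_iff[of T "c j"] by (auto simp: S_def)
    then have "s t ^ d \<le> 0" if "t \<in> T" for t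
      using le[OF that] j that D prod_zero[of D "\<lambda>j. c j t"] by (fastforce simp: d_def)
    then have "s t = 0" if "t \<in> T" for t
      using s[OF that] that d by (metis leD less_eq_real_def zero_less_power)
    then have "(\<Sum>t\<in>T. s t) ^ card D = 0" using d by (simp add: d_def)
    then show ?thesis using K S0 by (simp only: S_def) (auto intro!: mult_nonneg_nonneg prod_nonneg)
  next
    case False
    with S0 have Sp: "S j > 0" if "j \<in> D" for j
      using that by (metis less_eq_real_def)
    define P where "P = K * (\<Prod>j\<in>D. S j)"
    have P0: "P \<ge> 0" unfolding P_def using K S0 by (intro mult_nonneg_nonneg prod_nonneg) auto
    have root_eq: "root d y = y powr (1 / d)" if "y \<ge> 0" for y
      using that d root_powr_inverse[of d y] by (cases "y = 0") auto
    have st: "s t \<le> root d P * ((\<Sum>j\<in>D. c j t / S j) / d)" if t: "t \<in> T" for t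
    proof -
      have "s t = root d (s t ^ d)" using s[OF t] d by (simp add: real_root_power_cancel)
      also have "\<dots> \<le> root d (P * (\<Prod>j\<in>D. c j t / S j))"
      proof (rule real_root_le_mono[OF d])
        have "(\<Prod>j\<in>D. S j) \<noteq> 0" using False D by simp
        then have "P * (\<Prod>j\<in>D. c j t / S j) = K * (\<Prod>j\<in>D. c j t)"
          by (simp add: P_def prod_dividef)
        then show "s t ^ d \<le> P * (\<Prod>j\<in>D. c j t / S j)" using le[OF t] by (simp add: d_def)
      qed
      also have "\<dots> = root d P * root d (\<Prod>j\<in>D. c j t / S j)" by (simp add: real_root_mult)
      also have "\<dots> \<le> root d P * ((\<Sum>j\<in>D. c j t / S j) / d)"
      proof (rule mult_left_mono)
        show "root d (\<Prod>j\<in>D. c j t / S j) \<le> (\<Sum>j\<in>D. c j t / S j) / d"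
        proof -
          have nonneg: "0 \<le> c j t / S j" if "j \<in> D" for j
            using c[OF that t] Sp[OF that] by simp
          then have "root d (\<Prod>j\<in>D. c j t / S j) = (\<Prod>j\<in>D. c j t / S j) powr (1 / card D)"
            unfolding d_def[symmetric] by (intro root_eq prod_nonneg) auto
          also have "\<dots> \<le> (\<Sum>j\<in>D. c j t / S j / card D)"
            using D nonneg by (intro arith_geom_mean) auto
          finally show ?thesis by (simp add: d_def sum_divide_distrib)
        qed
      qed (use P0 in \<open>simp add: real_root_ge_zero\<close>)
      finally show ?thesis .
    qed
    \<comment> \<open>For each \<open>j\<close> the normalised weights sum to 1 over
      \<open>t\<close>, so the averages over \<open>D\<close> also sum to 1 and only
      \<open>root d P\<close> remains.\<close>
    have "(\<Sum>t\<in>T. s t) \<le> (\<Sum>t\<in>T. root d P * ((\<Sum>j\<in>D. c j t / S j) / d))"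
      by (intro sum_mono st)
    also have "\<dots> = root d P * ((\<Sum>t\<in>T. \<Sum>j\<in>D. c j t / S j) / d)"
      by (simp add: sum_distrib_left sum_divide_distrib)
    also have "(\<Sum>t\<in>T. \<Sum>j\<in>D. c j t / S j) = (\<Sum>j\<in>D. \<Sum>t\<in>T. c j t / S j)" by (rule sum.swap)
    also have "\<dots> = (\<Sum>j\<in>D. 1)"
      using False by (intro sum.cong) (auto simp: S_def simp flip: sum_divide_distrib)
    also have "root d P * ((\<Sum>j\<in>D. 1) / d) = root d P" using d by (simp add: d_def)
    finally have "(\<Sum>t\<in>T. s t) ^ d \<le> root d P ^ d"
      using s by (intro power_mono sum_nonneg) auto
    also have "\<dots> = P" using d P0 by (simp add: real_root_pow_pos2)
    finally show ?thesis by (simp add: d_def P_def S_def)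
  qed
qed

text \<open>The projection is sliced by the value at \<open>x\<close>; within a slice that value is
  constant, so forgetting it is injective.\<close>

lemma card_restrict_image_insert:
  fixes V :: "('i \<Rightarrow> 'a) set"
  assumes V: "finite V" and x: "x \<notin> Y"
  shows "card ((\<lambda>v. restrict v (insert x Y)) ` V) =
    (\<Sum>t\<in>(\<lambda>v. v x) ` V. card ((\<lambda>v. restrict v Y) ` {v\<in>V. v x = t}))"
proof -
  let ?W = "(\<lambda>v. restrict v (insert x Y)) ` V"
  have "card ?W = (\<Sum>t\<in>(\<lambda>v. v x) ` ?W. card {w\<in>?W. w x = t})"
    using sum.image_gen[of ?W "\<lambda>_. 1::nat" "\<lambda>v. v x"] V by simp
  also have "(\<lambda>v. v x) ` ?W = (\<lambda>v. v x) ` V"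
    by (auto simp: image_image)
  finally have "card ?W = (\<Sum>t\<in>(\<lambda>v. v x) ` V. card {w\<in>?W. w x = t})" .
  moreover have "card {w\<in>?W. w x = t} = card ((\<lambda>v. restrict v Y) ` {v\<in>V. v x = t})" for t
  proof (rule bij_betw_same_card[of "\<lambda>w. restrict w Y"], rule bij_betwI')
    fix v w assume "v \<in> {w\<in>?W. w x = t}" "w \<in> {w\<in>?W. w x = t}"
    then obtain v' w' where [simp]: "v = restrict v' (insert x Y)" "w = restrict w' (insert x Y)"
      and t: "v' x = t" "w' x = t" by auto
    show "(restrict v Y = restrict w Y) = (v = w)"
    proof
      assume eq: "restrict v Y = restrict w Y"
      show "v = w"
      proof
        fix i show "v i = w i"
          using fun_cong[OF eq, of i] t by (auto simp: restrict_def split: if_splits)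
      qed
    qed simp
  next
    fix w assume "w \<in> {w\<in>?W. w x = t}"
    then obtain w' where "w' \<in> V" "w = restrict w' (insert x Y)" "w' x = t" by auto
    moreover then have "restrict w Y = restrict w' Y" by (auto simp: restrict_def)
    ultimately show "restrict w Y \<in> (\<lambda>v. restrict v Y) ` {v\<in>V. v x = t}" by auto
  next
    fix u assume "u \<in> (\<lambda>v. restrict v Y) ` {v\<in>V. v x = t}"
    then obtain v where v: "v \<in> V" "v x = t" "u = restrict v Y" by auto
    have "u = restrict (restrict v (insert x Y)) Y" using v by (auto simp: restrict_def)
    with v show "\<exists>w\<in>{w\<in>?W. w x = t}. u = restrict w Y"
      by (intro bexI[of _ "restrict v (insert x Y)"]) auto
  qed
  ultimately show ?thesis by simp
qed

text \<open>Induction on \<open>X\<close>: slice \<open>V\<close> by the value at the new coordinate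
  \<open>x\<close> and apply the induction hypothesis to each slice. Exactly \<open>d\<close> of the
  sets \<open>F j\<close> contain \<open>x\<close>; their projections split over the slices, and
  Hoelder recombines these \<open>d\<close> sums.\<close>

lemma Shearer_inequality:
  fixes V :: "('i \<Rightarrow> 'a) set" and F :: "'j \<Rightarrow> 'i set"
  assumes "finite X" and J: "finite J" and d: "d > 0"
    and "finite V" and "\<And>x. x \<in> X \<Longrightarrow> card {j\<in>J. x \<in> F j} = d"
  shows "card ((\<lambda>v. restrict v X) ` V) ^ d \<le> (\<Prod>j\<in>J. card ((\<lambda>v. restrict v (F j \<inter> X)) ` V))"
  using assms(1,4,5)
proof (induction X arbitrary: V rule: finite_induct)
  case empty
  have "card ((\<lambda>v. restrict v {}) ` V) = (if V = {} then 0 else 1)"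
    by (auto simp: restrict_def image_constant_conv)
  then show ?case using d J by (auto simp: restrict_def image_constant_conv zero_power)
next
  case (insert x X)
  define p where "p Y t = card ((\<lambda>v. restrict v Y) ` {v\<in>V. v x = t})" for Y t
  define T where "T = (\<lambda>v. v x) ` V"
  have T: "finite T" using insert.prems by (simp add: T_def)
  define D where "D = {j\<in>J. x \<in> F j}"
  have D: "finite D" "card D = d" "D \<subseteq> J" using insert.prems J by (auto simp: D_def)
  then have D0: "D \<noteq> {}" using d by auto
  have split: "card ((\<lambda>v. restrict v (insert x Y)) ` V) = (\<Sum>t\<in>T. p Y t)" if "x \<notin> Y" for Y
    using card_restrict_image_insert[of V x Y] insert.prems(1) that by (simp add: T_def p_def)
  \<comment> \<open>The sets \<open>F j\<close> without \<open>x\<close> do not see the slicing.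
    Bounding their slice projections by those of all of \<open>V\<close> gives a factor independent
    of \<open>t\<close>.\<close>
  define K where "K = (\<Prod>j\<in>J-D. card ((\<lambda>v. restrict v (F j \<inter> X)) ` V))"
  have "p X t ^ d \<le> K * (\<Prod>j\<in>D. p (F j \<inter> X) t)" for t
  proof -
    have "p X t ^ d \<le> (\<Prod>j\<in>J. p (F j \<inter> X) t)"
      unfolding p_def using insert.prems by (intro insert.IH) auto
    also have "\<dots> = (\<Prod>j\<in>J-D. p (F j \<inter> X) t) * (\<Prod>j\<in>D. p (F j \<inter> X) t)"
      using J D by (simp add: prod.subset_diff)
    also have "\<dots> \<le> K * (\<Prod>j\<in>D. p (F j \<inter> X) t)"
      unfolding K_def p_def using insert.prems
      by (intro mult_right_mono prod_mono) (auto intro!: card_mono)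
    finally show ?thesis .
  qed
  then have "real (p X t ^ d) \<le> real (K * (\<Prod>j\<in>D. p (F j \<inter> X) t))" for t
    by (simp only: of_nat_le_iff)
  then have "real (p X t) ^ card D \<le> real K * (\<Prod>j\<in>D. real (p (F j \<inter> X) t))" for t
    by (simp only: D of_nat_mult of_nat_power of_nat_prod)
  then have "(\<Sum>t\<in>T. real (p X t)) ^ card D \<le> real K * (\<Prod>j\<in>D. \<Sum>t\<in>T. real (p (F j \<inter> X) t))"
    using T D D0 by (intro Hoelder_sum_prod) simp_all
  then have "(\<Sum>t\<in>T. p X t) ^ d \<le> K * (\<Prod>j\<in>D. \<Sum>t\<in>T. p (F j \<inter> X) t)"
    by (simp only: D of_nat_le_iff flip: of_nat_sum of_nat_prod of_nat_mult of_nat_power)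
  also have "(\<Prod>j\<in>D. \<Sum>t\<in>T. p (F j \<inter> X) t) =
      (\<Prod>j\<in>D. card ((\<lambda>v. restrict v (F j \<inter> insert x X)) ` V))"
    using insert.hyps by (intro prod.cong) (auto simp: D_def split[symmetric] Int_insert_right)
  also have "K = (\<Prod>j\<in>J-D. card ((\<lambda>v. restrict v (F j \<inter> insert x X)) ` V))"
    unfolding K_def by (intro prod.cong) (auto simp: D_def)
  also have "\<dots> * (\<Prod>j\<in>D. card ((\<lambda>v. restrict v (F j \<inter> insert x X)) ` V)) =
      (\<Prod>j\<in>J. card ((\<lambda>v. restrict v (F j \<inter> insert x X)) ` V))"
    using J D by (simp add: prod.subset_diff)
  finally show ?case by (simp only: split[OF insert.hyps(2)])
qed

section \<open>Centres of discrete skeleta\<close>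

definition discrete_skeleton :: "nat \<Rightarrow> ('n \<Rightarrow> int) \<Rightarrow> int \<Rightarrow> ('n \<Rightarrow> int) set" where
  "discrete_skeleton k a m =
     {b. \<exists>I. card I = k \<and> (\<forall>i. if i \<in> I then \<bar>b i - a i\<bar> \<le> m else \<bar>b i - a i\<bar> = m)}"

section \<open>Bounding a set by its projections along \<open>k\<close> coordinates\<close>

lemma card_subsets_avoiding:
  fixes i :: "'n::finite"
  shows "card {I. card I = k \<and> i \<notin> I} = (CARD('n) - 1) choose k"
proof -
  have "{I. card I = k \<and> i \<notin> I} = {I. I \<subseteq> UNIV - {i} \<and> card I = k}" by auto
  also have "card \<dots> = card (UNIV - {i}) choose k" by (intro n_subsets) auto
  finally show ?thesis by (simp add: card_Diff_singleton)
qed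

lemma card_subsets_UNIV: "card {I :: 'n::finite set. card I = k} = CARD('n) choose k"
  using n_subsets[of "UNIV :: 'n set" k] by simp

text \<open>Shearer is applied to the complements of all \<open>k\<close>-element sets. A coordinate
  lies in \<open>c = (n-1 choose k)\<close> of these \<open>C = (n choose k)\<close> complements, so
  \<open>card V\<close> is at most \<open>P\<close> to the power
  \<open>C / c = n / (n - k)\<close>.\<close>

lemma card_le_of_projections:
  fixes V :: "('n::finite \<Rightarrow> 'a) set"
  assumes V: "finite V" and k: "k < CARD('n)" and P: "0 \<le> P"
    and proj: "\<And>I. card I = k \<Longrightarrow> real (card ((\<lambda>v. restrict v (- I)) ` V)) \<le> P"
  shows "real (card V) ^ (CARD('n) - k) \<le> P ^ CARD('n)"
proof -
  let ?n = "CARD('n)"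
  define c where "c = (?n - 1) choose k"
  define C where "C = ?n choose k"
  have c0: "c > 0" using k by (auto simp: c_def zero_less_binomial_iff)
  have nc: "(?n - k) * C = ?n * c" by (simp add: c_def C_def binomial_absorb_comp)
  have "card ((\<lambda>v. restrict v UNIV) ` V) ^ c
      \<le> (\<Prod>I\<in>{I. card I = k}. card ((\<lambda>v. restrict v (- I \<inter> UNIV)) ` V))"
    using c0 V by (intro Shearer_inequality) (auto simp: c_def card_subsets_avoiding)
  then have "card V ^ c \<le> (\<Prod>I\<in>{I. card I = k}. card ((\<lambda>v. restrict v (- I)) ` V))"
    by (simp add: restrict_def[of _ UNIV])
  then have "real (card V ^ c) \<le> real (\<Prod>I\<in>{I. card I = k}. card ((\<lambda>v. restrict v (- I)) ` V))"
    by (simp only: of_nat_le_iff)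
  also have "\<dots> \<le> (\<Prod>I\<in>{I::'n set. card I = k}. P)"
    unfolding of_nat_prod using proj by (intro prod_mono) auto
  also have "\<dots> = P ^ C" by (simp add: C_def card_subsets_UNIV)
  finally have le: "real (card V) ^ c \<le> P ^ C" by simp
  show ?thesis
  proof (cases "V = {}")
    case False
    with V have pos: "real (card V) > 0" by (simp add: card_gt_0_iff)
    with le c0 have "P ^ C > 0" by (smt (verit) zero_less_power)
    moreover have C0: "C > 0" using k by (simp add: C_def zero_less_binomial_iff)
    ultimately have Ppos: "P > 0" using P by (metis less_eq_real_def power_0_left zero_power less_irrefl)
    \<comment> \<open>By \<open>nc\<close>, the exponent \<open>c * n\<close> equals
      \<open>(n - k) * C\<close>, so the common exponent \<open>C\<close> can be cancelled
      afterwards.\<close>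
    have "(real (card V) ^ c) ^ ?n \<le> (P ^ C) ^ ?n" using le by (intro power_mono) auto
    then have "(real (card V) ^ (?n - k)) ^ C \<le> (P ^ ?n) ^ C"
      by (metis nc power_mult mult.commute)
    then show ?thesis using C0 Ppos by (simp add: power_mono_iff)
  qed (use k P in \<open>simp add: zero_power\<close>)
qed

section \<open>Counting centres by lines, cells and dyadic scales\<close>

lemma card_le_square_of_injection:
  fixes f :: "'a \<Rightarrow> 'b \<times> 'b"
  assumes "inj_on f X" "f ` X \<subseteq> Y \<times> Y" "finite Y"
  shows "card X \<le> card Y ^ 2"
  using card_inj_on_le[OF assms(1,2)] assms(3) by (simp add: card_cartesian_product power2_eq_square)

lemma div_eq_iff_atLeastLessThan:
  fixes x q :: int
  assumes "R > 0"
  shows "x div int R = q \<longleftrightarrow> x \<in> {int R * q..<int R * q + int R}"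
proof
  assume "x div int R = q"
  then have "x = int R * q + x mod int R" by (metis mult_div_mod_eq)
  moreover have "0 \<le> x mod int R" "x mod int R < int R" using assms by simp_all
  ultimately show "x \<in> {int R * q..<int R * q + int R}" by (simp del: pos_mod_sign pos_mod_bound)
next
  assume "x \<in> {int R * q..<int R * q + int R}"
  then show "x div int R = q"
    by (intro int_div_pos_eq[of _ _ _ "x - int R * q"]) auto
qed

text \<open>On a line of direction \<open>(1, \<dots>, 1)\<close> every centre is the midpoint of two points of \<open>V\<close>,
  so \<open>s\<close> points of \<open>V\<close> on that line account for at most \<open>s\<^sup>2\<close> centres.\<close>
lemma card_centres_le_sqrt_times_vertices:
  fixes A V :: "('n::finite \<Rightarrow> int) set" and R :: nat
  assumes A: "finite A" and V: "finite V"
    and cell: "\<And>a i. a \<in> A \<Longrightarrow> a i div int R = q i"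
    and R: "R > 0"
    and vert: "\<And>a. a \<in> A \<Longrightarrow> (\<lambda>i. a i + m a) \<in> V \<and> (\<lambda>i. a i - m a) \<in> V"
  shows "real (card A) \<le> sqrt (real R) * real (card V)"
proof -
  define i0 :: 'n where "i0 = undefined"
  \<comment> \<open>The differences to a reference coordinate label the lines of direction (1, ...,
    1): adding a constant to all coordinates leaves \<open>d\<close> unchanged.\<close>
  define d :: "('n \<Rightarrow> int) \<Rightarrow> 'n \<Rightarrow> int" where "d v = (\<lambda>i. v i - v i0)" for v
  define VL where "VL l = {v\<in>V. d v = l}" for l
  define AL where "AL l = {a\<in>A. d a = l}" for l
  have fin: "finite (VL l)" "finite (AL l)" for l using A V by (auto simp: VL_def AL_def)
  have AR: "card (AL l) \<le> R" for l
  proof -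
    have "inj_on (\<lambda>a. a i0) (AL l)"
    proof (rule inj_onI)
      fix a b assume ab: "a \<in> AL l" "b \<in> AL l" "a i0 = b i0"
      show "a = b"
      proof
        fix i
        have "d a i = d b i" using ab by (simp add: AL_def)
        then show "a i = b i" using ab by (simp add: d_def)
      qed
    qed
    moreover have "(\<lambda>a. a i0) ` AL l \<subseteq> {int R * q i0..<int R * q i0 + int R}"
    proof
      fix x assume "x \<in> (\<lambda>a. a i0) ` AL l"
      then show "x \<in> {int R * q i0..<int R * q i0 + int R}"
        using cell div_eq_iff_atLeastLessThan[OF R] by (auto simp: AL_def)
    qed
    ultimately have "card (AL l) \<le> card {int R * q i0..<int R * q i0 + int R}"
      by (intro card_inj_on_le) auto
    then show ?thesis by simp
  qed
  have AV: "card (AL l) \<le> card (VL l) ^ 2" for l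
  proof (rule card_le_square_of_injection)
    show "inj_on (\<lambda>a. (\<lambda>i. a i + m a, \<lambda>i. a i - m a)) (AL l)"
    proof (rule inj_onI)
      fix a b assume eq: "(\<lambda>i. a i + m a, \<lambda>i. a i - m a) = (\<lambda>i. b i + m b, \<lambda>i. b i - m b)"
      show "a = b"
      proof
        fix i
        have "a i + m a = b i + m b" "a i - m a = b i - m b"
          using eq by (auto dest: fun_cong[of _ _ i])
        then show "a i = b i" by simp
      qed
    qed
    show "(\<lambda>a. (\<lambda>i. a i + m a, \<lambda>i. a i - m a)) ` AL l \<subseteq> VL l \<times> VL l"
      using vert by (auto simp: AL_def VL_def d_def)
  qed (fact fin)
  \<comment> \<open>Geometric mean of the two bounds for one line: \<open>R\<close> because the line
    stays in one cell, and the square of \<open>card (VL l)\<close>.\<close>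
  have ALVL: "real (card (AL l)) \<le> sqrt (real R) * real (card (VL l))" for l
  proof -
    have "real (card (AL l)) ^ 2 = real (card (AL l)) * real (card (AL l))"
      by (simp add: power2_eq_square)
    also have "\<dots> \<le> real R * real (card (VL l) ^ 2)"
      using AR AV by (intro mult_mono) (auto simp del: of_nat_power)
    also have "\<dots> = (sqrt (real R) * real (card (VL l))) ^ 2"
      by (simp add: power_mult_distrib)
    finally show ?thesis by (rule power2_le_imp_le) simp
  qed
  have "real (card A) = (\<Sum>l\<in>d ` A. real (card (AL l)))"
    using sum.image_gen[OF A, of "\<lambda>_. 1::real" d] by (simp add: AL_def)
  also have "\<dots> \<le> (\<Sum>l\<in>d ` A. sqrt (real R) * real (card (VL l)))" by (intro sum_mono ALVL)
  also have "\<dots> = sqrt (real R) * (\<Sum>l\<in>d ` A. real (card (VL l)))" by (simp add: sum_distrib_left)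
  \<comment> \<open>The index set is enlarged so that its lines cover all of
    \<open>V\<close>.\<close>
  also have "(\<Sum>l\<in>d ` A. real (card (VL l))) \<le> (\<Sum>l\<in>d ` (A \<union> V). real (card (VL l)))"
    using A V by (intro sum_mono2) auto
  also have "\<dots> = real (card V)"
    using sum.group[of V "d ` (A \<union> V)" d "\<lambda>_. 1::real"] A V by (simp add: VL_def image_Un)
  finally show ?thesis using R by simp
qed

text \<open>The lower bound on \<open>m\<close> makes every face through a chosen vertex cross the
  whole cell; the upper bound keeps the points used within two cells of it. The line argument,
  Shearer and the trivial bound by the cell's volume are then combined.\<close>

lemma card_centres_in_cell:
  fixes A B :: "('n::finite \<Rightarrow> int) set" and R :: nat
  assumes A: "finite A" and B: "finite B" and k: "k < CARD('n)" and R: "R > 0"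
    and cell: "\<And>a i. a \<in> A \<Longrightarrow> a i div int R = q i"
    and m: "\<And>a. a \<in> A \<Longrightarrow> int R \<le> m a + 1 \<and> m a + 1 < 2 * int R"
    and skel: "\<And>a. a \<in> A \<Longrightarrow> discrete_skeleton k a (m a) \<subseteq> B"
  shows "real (card A) \<le> real R powr (real (CARD('n) - k) / (2 * real CARD('n)))
    * real (card {b\<in>B. \<forall>i. \<bar>b i div int R - q i\<bar> \<le> 2})"
proof -
  let ?n = "CARD('n)"
  define BQ where "BQ = {b\<in>B. \<forall>i. \<bar>b i div int R - q i\<bar> \<le> 2}"
  have BQ: "finite BQ" using B by (simp add: BQ_def)
  define V where "V = (\<lambda>a i. a i + m a) ` A \<union> (\<lambda>a i. a i - m a) ` A"
  have V: "finite V" using A by (simp add: V_def)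
  have near: "\<bar>v i div int R - q i\<bar> \<le> 2" if "a \<in> A" "v i = a i + m a \<or> v i = a i - m a" for a v i
  proof -
    have "int R * q i \<le> a i" "a i < int R * q i + int R"
      using cell[OF that(1), of i] R by (auto simp: div_eq_iff_atLeastLessThan)
    then have "int R * (q i - 2) \<le> v i" "v i < int R * (q i + 3)"
      using that m[OF that(1)] by (auto simp: algebra_simps)
    moreover have "int R * (v i div int R) \<le> v i" "v i < int R * (v i div int R + 1)"
      using div_eq_iff_atLeastLessThan[OF R, of "v i" "v i div int R"] by (auto simp: algebra_simps)
    ultimately have "int R * (q i - 2) < int R * (v i div int R + 1)"
      "int R * (v i div int R) < int R * (q i + 3)" by linarith+
    then have "q i - 2 < v i div int R + 1" "v i div int R < q i + 3"
      using R by (simp_all del: right_diff_distrib distrib_left)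
    then show ?thesis by linarith
  qed
  \<comment> \<open>Over each projected vertex, the coordinates in \<open>I\<close> can be filled
    with any of the \<open>R ^ k\<close> choices from the cell without leaving
    \<open>BQ\<close>.\<close>
  have proj: "real (card ((\<lambda>v. restrict v (- I)) ` V)) \<le> real (card BQ) / real R ^ k"
    if I: "card I = k" for I
  proof -
    let ?W = "(\<lambda>v. restrict v (- I)) ` V"
    let ?C = "PiE I (\<lambda>i. {int R * q i..<int R * q i + int R})"
    let ?f = "\<lambda>(p, c) i. if i \<in> I then c i else p i"
    have "inj_on ?f (?W \<times> ?C)"
    proof (rule inj_onI, clarify, rule conjI)
      fix v w c e assume "c \<in> ?C" "e \<in> ?C"
        and eq: "(\<lambda>i. if i \<in> I then c i else restrict v (- I) i) =
          (\<lambda>i. if i \<in> I then e i else restrict w (- I) i)"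
      show "restrict v (- I) = restrict w (- I)"
      proof
        fix i show "restrict v (- I) i = restrict w (- I) i"
          using fun_cong[OF eq, of i] by (auto split: if_splits)
      qed
      show "c = e"
      proof (rule PiE_ext[OF \<open>c \<in> ?C\<close> \<open>e \<in> ?C\<close>])
        fix i assume "i \<in> I" then show "c i = e i" using fun_cong[OF eq, of i] by simp
      qed
    qed
    moreover have "?f ` (?W \<times> ?C) \<subseteq> BQ"
    proof clarify
      fix v c assume "v \<in> V" and c: "c \<in> ?C"
      then obtain a where a: "a \<in> A" and v: "\<And>i. v i = a i + m a \<or> v i = a i - m a"
        by (auto simp: V_def)
      define b where "b = (\<lambda>i. if i \<in> I then c i else restrict v (- I) i)"
      have cdiv: "c i div int R = q i" if "i \<in> I" for i
        using c that R by (subst div_eq_iff_atLeastLessThan) (auto dest: PiE_mem)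
      \<comment> \<open>Two integers in one block of length \<open>R\<close> differ by at most
        \<open>R - 1\<close>; this is why the hypothesis bounds \<open>m a + 1\<close> rather than
        \<open>m a\<close>.\<close>
      have "\<bar>c i - a i\<bar> \<le> m a" if "i \<in> I" for i
        using cdiv[OF that] cell[OF a, of i] m[OF a] R by (auto simp: div_eq_iff_atLeastLessThan)
      moreover have "\<bar>v i - a i\<bar> = m a" for i
        using v[of i] m[OF a] R by auto
      ultimately have "b \<in> discrete_skeleton k a (m a)"
        using I by (auto simp: discrete_skeleton_def b_def)
      moreover have "\<bar>b i div int R - q i\<bar> \<le> 2" for i
        using cdiv[of i] near[where a = a and v = v and i = i, OF a v] by (auto simp: b_def)
      ultimately show "(\<lambda>i. if i \<in> I then c i else restrict v (- I) i) \<in> BQ"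
        using skel[OF a] by (auto simp: BQ_def b_def)
    qed
    ultimately have "card (?W \<times> ?C) \<le> card BQ" using BQ by (intro card_inj_on_le)
    then have "card ?W * R ^ k \<le> card BQ" by (simp add: card_cartesian_product card_PiE I)
    then have "real (card ?W * R ^ k) \<le> real (card BQ)" by (simp only: of_nat_le_iff)
    then show ?thesis using R by (simp add: field_simps)
  qed
  have AV: "real (card A) \<le> sqrt (real R) * real (card V)"
    using A V cell R by (rule card_centres_le_sqrt_times_vertices[where m = m]) (auto simp: V_def)
  have VB: "real (card V) ^ (?n - k) \<le> (real (card BQ) / real R ^ k) ^ ?n"
    by (intro card_le_of_projections V k proj) auto
  have AR: "real (card A) \<le> real R ^ ?n"
  proof -
    have "A \<subseteq> PiE UNIV (\<lambda>i. {int R * q i..<int R * q i + int R})"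
      using cell R by (auto simp: div_eq_iff_atLeastLessThan)
    then have "card A \<le> card (PiE UNIV (\<lambda>i. {int R * q i..<int R * q i + int R}))"
      by (intro card_mono finite_PiE) auto
    also have "\<dots> = R ^ ?n" by (simp add: card_PiE)
    finally show ?thesis by (simp flip: of_nat_power)
  qed
  define \<rho> where "\<rho> = real R powr (real (?n - k) / (2 * real ?n))"
  have \<rho>_pow: "\<rho> ^ ?n = sqrt (real R) ^ (?n - k)"
  proof -
    have "\<rho> ^ ?n = real R powr (real (?n - k) / 2)"
      using R by (simp add: \<rho>_def powr_powr flip: powr_realpow)
    also have "\<dots> = (real R powr (1 / 2)) powr real (?n - k)" by (simp add: powr_powr)
    also have "\<dots> = sqrt (real R) ^ (?n - k)" using R by (simp add: powr_half_sqrt powr_realpow)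
    finally show ?thesis .
  qed
  \<comment> \<open>The line bound is spent on the first factor and the volume bound on the second.
    The resulting \<open>R ^ (n * k)\<close> cancels against the denominators from the
    projections.\<close>
  have "real (card A) ^ ?n = real (card A) ^ (?n - k) * real (card A) ^ k"
    using k by (simp flip: power_add)
  also have "\<dots> \<le> (sqrt (real R) * real (card V)) ^ (?n - k) * (real R ^ ?n) ^ k"
    by (intro mult_mono power_mono AV AR) auto
  also have "\<dots> = sqrt (real R) ^ (?n - k) * (real R ^ ?n) ^ k * real (card V) ^ (?n - k)"
    by (simp add: power_mult_distrib)
  also have "\<dots> \<le> sqrt (real R) ^ (?n - k) * (real R ^ ?n) ^ k * (real (card BQ) / real R ^ k) ^ ?n"
    by (intro mult_left_mono VB) auto
  also have "\<dots> = (\<rho> * real (card BQ)) ^ ?n"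
    using R by (simp add: \<rho>_pow power_mult_distrib power_divide mult.commute flip: power_mult)
  finally show ?thesis unfolding BQ_def[symmetric] \<rho>_def[symmetric]
    by (rule power_le_imp_le_base[where n = "?n - 1", simplified]) (simp add: \<rho>_def)
qed

text \<open>Summing the cell estimate is a double count: a point of \<open>B\<close> is near at most
  \<open>5 ^ n\<close> cells, since each cell index differs by at most 2.\<close>

lemma card_centres_one_scale:
  fixes A B :: "('n::finite \<Rightarrow> int) set" and R :: nat
  assumes A: "finite A" and B: "finite B" and k: "k < CARD('n)" and R: "R > 0"
    and m: "\<And>a. a \<in> A \<Longrightarrow> int R \<le> m a + 1 \<and> m a + 1 < 2 * int R"
    and skel: "\<And>a. a \<in> A \<Longrightarrow> discrete_skeleton k a (m a) \<subseteq> B"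
  shows "real (card A) \<le> 5 ^ CARD('n) * real R powr (real (CARD('n) - k) / (2 * real CARD('n)))
    * real (card B)"
proof -
  let ?\<rho> = "real R powr (real (CARD('n) - k) / (2 * real CARD('n)))"
  define cell where "cell a = (\<lambda>i. a i div int R)" for a :: "'n \<Rightarrow> int"
  let ?near = "\<lambda>b q :: 'n \<Rightarrow> int. \<forall>i. \<bar>b i div int R - q i\<bar> \<le> 2"
  define Q where "Q = cell ` A"
  have Q: "finite Q" using A by (simp add: Q_def)
  have few: "card {q\<in>Q. ?near b q} \<le> 5 ^ CARD('n)" for b
  proof -
    have "{q\<in>Q. ?near b q} \<subseteq> PiE UNIV (\<lambda>i. {b i div int R - 2..b i div int R + 2})"
      by (auto simp: abs_le_iff algebra_simps)
    then have "card {q\<in>Q. ?near b q} \<le> card (PiE UNIV (\<lambda>i. {b i div int R - 2..b i div int R + 2}))"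
      by (intro card_mono finite_PiE) auto
    then show ?thesis by (simp add: card_PiE)
  qed
  have "real (card A) = (\<Sum>q\<in>Q. real (card {a\<in>A. cell a = q}))"
    using sum.image_gen[OF A, of "\<lambda>_. 1::real" cell] by (simp add: Q_def)
  also have "\<dots> \<le> (\<Sum>q\<in>Q. ?\<rho> * real (card {b\<in>B. ?near b q}))"
    using A B k R m skel
    by (intro sum_mono card_centres_in_cell[where m = m]) (auto simp: cell_def)
  also have "\<dots> = ?\<rho> * (\<Sum>q\<in>Q. \<Sum>b\<in>{b\<in>B. ?near b q}. 1)" by (simp add: sum_distrib_left)
  also have "(\<Sum>q\<in>Q. \<Sum>b\<in>{b\<in>B. ?near b q}. 1::real) = (\<Sum>b\<in>B. \<Sum>q\<in>{q\<in>Q. ?near b q}. 1)"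
    by (rule sum.swap_restrict[OF Q B])
  also have "\<dots> = (\<Sum>b\<in>B. real (card {q\<in>Q. ?near b q}))" by simp
  also have "?\<rho> * \<dots> \<le> ?\<rho> * (\<Sum>b\<in>B. 5 ^ CARD('n))"
    using few by (intro mult_left_mono sum_mono) (auto simp flip: of_nat_le_iff)
  also have "\<dots> = 5 ^ CARD('n) * ?\<rho> * real (card B)" by simp
  finally show ?thesis .
qed

text \<open>Each induction step splits off the layer with \<open>m a + 1\<close> between
  \<open>2 ^ J\<close> and \<open>2 ^ (J + 1)\<close>. Measuring by \<open>m a + 1\<close> places
  radius 0 in the first layer, at scale \<open>R = 1\<close>.\<close>

lemma card_centres_dyadic:
  fixes A B :: "('n::finite \<Rightarrow> int) set"
  assumes A: "finite A" and B: "finite B" and k: "k < CARD('n)"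
    and m: "\<And>a. a \<in> A \<Longrightarrow> 0 \<le> m a \<and> m a + 1 < 2 ^ J"
    and skel: "\<And>a. a \<in> A \<Longrightarrow> discrete_skeleton k a (m a) \<subseteq> B"
  shows "real (card A) \<le> 5 ^ CARD('n) * real (card B) *
    (\<Sum>j<J. (2 powr (real (CARD('n) - k) / (2 * real CARD('n)))) ^ j)"
  using A m skel
proof (induction J arbitrary: A)
  case 0
  then have "A = {}" by force
  then show ?case by simp
next
  case (Suc J)
  let ?\<theta> = "real (CARD('n) - k) / (2 * real CARD('n))"
  define A0 where "A0 = {a\<in>A. m a + 1 < 2 ^ J}"
  define A1 where "A1 = {a\<in>A. 2 ^ J \<le> m a + 1}"
  have "A = A0 \<union> A1" by (auto simp: A0_def A1_def)
  then have "card A \<le> card A0 + card A1" by (metis card_Un_le)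
  moreover have "real (card A0) \<le> 5 ^ CARD('n) * real (card B) * (\<Sum>j<J. (2 powr ?\<theta>) ^ j)"
    using Suc.prems by (intro Suc.IH) (auto simp: A0_def)
  moreover have "real (card A1) \<le> 5 ^ CARD('n) * real (2 ^ J) powr ?\<theta> * real (card B)"
    using Suc.prems B k by (intro card_centres_one_scale[where m = m]) (auto simp: A1_def)
  moreover have "real (2 ^ J) powr ?\<theta> = (2 powr ?\<theta>) ^ J"
    by (simp add: powr_powr mult.commute flip: powr_realpow)
  ultimately show ?case by (simp add: algebra_simps)
qed

text \<open>As \<open>k < n\<close>, the ratio \<open>2 powr \<theta>\<close> exceeds 1, so the
  geometric series over the scales is comparable to its last term and no logarithm is lost.\<close>

lemma card_discrete_centres:
  fixes A B :: "('n::finite \<Rightarrow> int) set" and L :: nat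
  assumes A: "finite A" and B: "finite B" and k: "k < CARD('n)" and L: "L > 0"
    and m: "\<And>a. a \<in> A \<Longrightarrow> 0 \<le> m a \<and> m a + 1 \<le> int L"
    and skel: "\<And>a. a \<in> A \<Longrightarrow> discrete_skeleton k a (m a) \<subseteq> B"
    and \<theta>: "\<theta> = real (CARD('n) - k) / (2 * real CARD('n))"
  shows "real (card A) \<le> 5 ^ CARD('n) / (2 powr \<theta> - 1) * (2 * real L) powr \<theta> * real (card B)"
proof -
  obtain j where j: "2 ^ j \<le> L" "L < 2 ^ (j + 1)" using ex_power_ivl1[of 2 L] L by auto
  have \<theta>0: "\<theta> > 0" using k by (simp add: \<theta>)
  then have gt: "2 powr \<theta> > 1" by simp
  have "int L < 2 ^ (j + 1)" using j(2) by (metis of_nat_less_numeral_power_cancel_iff)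
  then have "m a + 1 < 2 ^ (j + 1)" if "a \<in> A" for a using m[OF that] by linarith
  then have "real (card A) \<le> 5 ^ CARD('n) * real (card B) * (\<Sum>i<j + 1. (2 powr \<theta>) ^ i)"
    unfolding \<theta> using A B k m skel by (intro card_centres_dyadic[where m = m]) auto
  also have "\<dots> \<le> 5 ^ CARD('n) * real (card B) * ((2 * real L) powr \<theta> / (2 powr \<theta> - 1))"
  proof (rule mult_left_mono)
    have "(\<Sum>i<j + 1. (2 powr \<theta>) ^ i) = ((2 powr \<theta>) ^ (j + 1) - 1) / (2 powr \<theta> - 1)"
      using gt by (intro geometric_sum) auto
    also have "\<dots> \<le> (2 * real L) powr \<theta> / (2 powr \<theta> - 1)"
    proof (rule divide_right_mono)
      have "(2 powr \<theta>) ^ (j + 1) = (2 * 2 ^ j) powr \<theta>"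
        by (simp add: powr_powr powr_mult mult.commute flip: powr_realpow)
      also have "\<dots> \<le> (2 * real L) powr \<theta>"
        using j \<theta>0 by (intro powr_mono2) (auto simp flip: of_nat_le_iff)
      finally show "(2 powr \<theta>) ^ (j + 1) - 1 \<le> (2 * real L) powr \<theta>" by simp
    qed (use gt in simp)
    finally show "(\<Sum>i<j + 1. (2 powr \<theta>) ^ i) \<le> (2 * real L) powr \<theta> / (2 powr \<theta> - 1)" .
  qed simp
  finally show ?thesis by (simp add: mult_ac)
qed

section \<open>Discretisation\<close>

definition grid :: "real \<Rightarrow> real ^ 'n \<Rightarrow> 'n \<Rightarrow> int" where
  "grid \<delta> x = (\<lambda>i. \<lfloor>x $ i / \<delta>\<rfloor>)"

text \<open>Absorbs the error of at most 1 between \<open>\<lfloor>(x \<plusminus> r) / \<delta>\<rfloor>\<close> and \<open>\<lfloor>x / \<delta>\<rfloor> \<plusminus> \<lfloor>r / \<delta>\<rfloor>\<close>.\<close>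

definition thicken :: "('n \<Rightarrow> int) set \<Rightarrow> ('n \<Rightarrow> int) set" where
  "thicken S = (\<Union>s\<in>S. PiE UNIV (\<lambda>i. {s i - 1..s i + 1}))"

section \<open>Grid counts versus covering numbers\<close>

lemma finite_grid_image:
  fixes A :: "(real ^ 'n) set"
  assumes "bounded A" "\<delta> > 0"
  shows "finite (grid \<delta> ` A)"
proof -
  obtain M where M: "\<And>x. x \<in> A \<Longrightarrow> norm x \<le> M" using assms by (auto simp: bounded_iff)
  have "grid \<delta> ` A \<subseteq> PiE UNIV (\<lambda>_. {\<lfloor>- M / \<delta>\<rfloor>..\<lfloor>M / \<delta>\<rfloor>})"
  proof (intro image_subsetI PiE_I)
    fix x i assume "x \<in> A"
    then have "\<bar>x $ i\<bar> \<le> M" using M component_le_norm_cart order_trans by blast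
    then have "- M / \<delta> \<le> x $ i / \<delta>" "x $ i / \<delta> \<le> M / \<delta>"
      using assms by (intro divide_right_mono; linarith)+
    then show "grid \<delta> x i \<in> {\<lfloor>- M / \<delta>\<rfloor>..\<lfloor>M / \<delta>\<rfloor>}"
      unfolding grid_def using floor_mono by (metis atLeastAtMost_iff)
  qed simp
  then show ?thesis by (rule finite_subset) (auto intro: finite_PiE)
qed

text \<open>The diameter of a cell is bounded crudely through the l1 norm; a constant factor in the
  scale does not affect the dimension.\<close>

lemma finite_cover_by_grid_cells:
  fixes A :: "(real ^ 'n) set"
  assumes "bounded A" "\<delta> > 0"
  obtains \<U> where "finite \<U>" "card \<U> \<le> card (grid \<delta> ` A)" "A \<subseteq> \<Union>\<U>"
    "\<forall>U\<in>\<U>. bounded U \<and> diameter U \<le> real CARD('n) * \<delta>"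
proof
  let ?c = "\<lambda>g. {x\<in>A. grid \<delta> x = g}"
  let ?\<U> = "?c ` grid \<delta> ` A"
  show "finite ?\<U>" using finite_grid_image[OF assms] by simp
  show "card ?\<U> \<le> card (grid \<delta> ` A)" using finite_grid_image[OF assms] by (rule card_image_le)
  show "A \<subseteq> \<Union>?\<U>" by auto
  show "\<forall>U\<in>?\<U>. bounded U \<and> diameter U \<le> real CARD('n) * \<delta>"
  proof (clarify, rule conjI)
    fix z
    show "bounded (?c (grid \<delta> z))" using assms(1) by (rule bounded_subset) auto
    show "diameter (?c (grid \<delta> z)) \<le> real CARD('n) * \<delta>"
    proof (rule diameter_le)
      show "?c (grid \<delta> z) \<noteq> {} \<or> 0 \<le> real CARD('n) * \<delta>" using assms by simp
      fix x y assume xy: "x \<in> ?c (grid \<delta> z)" "y \<in> ?c (grid \<delta> z)"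
      have "\<bar>(x - y) $ i\<bar> \<le> \<delta>" for i
      proof -
        have "grid \<delta> x i = grid \<delta> y i" using xy by simp
        then have "\<lfloor>x $ i / \<delta>\<rfloor> = \<lfloor>y $ i / \<delta>\<rfloor>" by (simp add: grid_def)
        then have "\<bar>x $ i / \<delta> - y $ i / \<delta>\<bar> \<le> 1" by linarith
        then have "\<bar>x $ i - y $ i\<bar> / \<delta> \<le> 1"
          using assms(2) by (simp add: abs_divide flip: diff_divide_distrib)
        then show ?thesis using assms(2) by (simp add: field_simps)
      qed
      then have "(\<Sum>i\<in>UNIV. \<bar>(x - y) $ i\<bar>) \<le> (\<Sum>i\<in>(UNIV::'n set). \<delta>)" by (intro sum_mono)
      then show "norm (x - y) \<le> real CARD('n) * \<delta>"
        using norm_le_l1_cart[of "x - y"] by simp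
    qed
  qed
qed

lemma covering_number_le_card_grid:
  fixes A :: "(real ^ 'n) set"
  assumes "bounded A" "\<delta> > 0"
  shows "covering_number (real CARD('n) * \<delta>) A \<le> card (grid \<delta> ` A)"
proof -
  obtain \<U> where \<U>: "finite \<U>" "card \<U> \<le> card (grid \<delta> ` A)" "A \<subseteq> \<Union>\<U>"
    "\<forall>U\<in>\<U>. bounded U \<and> diameter U \<le> real CARD('n) * \<delta>"
    using finite_cover_by_grid_cells[OF assms] .
  have "covering_number (real CARD('n) * \<delta>) A \<le> card \<U>"
    unfolding covering_number_def using \<U> by (intro Least_le) blast
  then show ?thesis using \<U>(2) by linarith
qed

text \<open>Cells of side \<open>\<delta> / n\<close> have diameter at most \<open>\<delta>\<close>,
  so a finite cover exists and the \<open>LEAST\<close> in the definition is a genuine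
  minimum.\<close>

lemma covering_number_attained:
  fixes A :: "(real ^ 'n) set"
  assumes "bounded A" "\<delta> > 0"
  obtains \<U> where "finite \<U>" "card \<U> = covering_number \<delta> A" "A \<subseteq> \<Union>\<U>"
    "\<forall>U\<in>\<U>. bounded U \<and> diameter U \<le> \<delta>"
proof -
  have "\<delta> / real CARD('n) > 0" using assms by simp
  from finite_cover_by_grid_cells[OF assms(1) this] obtain \<V> where
    "finite \<V>" "A \<subseteq> \<Union>\<V>"
    "\<forall>U\<in>\<V>. bounded U \<and> diameter U \<le> real CARD('n) * (\<delta> / real CARD('n))" .
  then have "\<exists>\<U>. finite \<U> \<and> card \<U> = card \<V> \<and> A \<subseteq> \<Union>\<U> \<and> (\<forall>U\<in>\<U>. bounded U \<and> diameter U \<le> \<delta>)"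
    by (intro exI[of _ \<V>]) simp
  then have "\<exists>\<U>. finite \<U> \<and> card \<U> = covering_number \<delta> A \<and> A \<subseteq> \<Union>\<U> \<and>
      (\<forall>U\<in>\<U>. bounded U \<and> diameter U \<le> \<delta>)"
    unfolding covering_number_def by (rule LeastI)
  then show ?thesis using that by (elim exE conjE)
qed

text \<open>Points at distance at most \<open>\<delta>\<close> have grid indices differing by at
  most 1 in each coordinate, so one covering set meets at most \<open>3 ^ n\<close> cells.\<close>

lemma card_grid_le_covering_number:
  fixes B :: "(real ^ 'n) set"
  assumes B: "bounded B" and \<delta>: "\<delta> > 0"
  shows "card (grid \<delta> ` B) \<le> 3 ^ CARD('n) * covering_number \<delta> B"
proof -
  obtain \<U> where \<U>: "finite \<U>" "card \<U> = covering_number \<delta> B" "B \<subseteq> \<Union>\<U>"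
    "\<forall>U\<in>\<U>. bounded U \<and> diameter U \<le> \<delta>"
    using covering_number_attained[OF assms] .
  have small: "card (grid \<delta> ` U) \<le> 3 ^ CARD('n)" if U: "U \<in> \<U>" for U
  proof (cases "U = {}")
    case False
    then obtain u where u: "u \<in> U" by blast
    have "grid \<delta> ` U \<subseteq> PiE UNIV (\<lambda>i. {grid \<delta> u i - 1..grid \<delta> u i + 1})"
    proof (intro image_subsetI PiE_I)
      fix v i assume v: "v \<in> U"
      have "\<bar>v $ i - u $ i\<bar> \<le> norm (v - u)" using component_le_norm_cart[of "v - u" i] by simp
      also have "\<dots> \<le> \<delta>"
        using diameter_bounded_bound[of U v u] u v \<U>(4) U by (fastforce simp: dist_norm)
      finally have "\<bar>v $ i - u $ i\<bar> / \<delta> \<le> 1" using \<delta> by (simp add: field_simps)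
      then have "\<bar>v $ i / \<delta> - u $ i / \<delta>\<bar> \<le> 1"
        using \<delta> by (simp add: abs_divide flip: diff_divide_distrib)
      then have "\<lfloor>u $ i / \<delta>\<rfloor> - 1 \<le> \<lfloor>v $ i / \<delta>\<rfloor>" "\<lfloor>v $ i / \<delta>\<rfloor> \<le> \<lfloor>u $ i / \<delta>\<rfloor> + 1"
        by linarith+
      then show "grid \<delta> v i \<in> {grid \<delta> u i - 1..grid \<delta> u i + 1}" by (simp add: grid_def)
    qed simp
    then have "card (grid \<delta> ` U) \<le> card (PiE UNIV (\<lambda>i. {grid \<delta> u i - 1..grid \<delta> u i + 1}))"
      by (intro card_mono finite_PiE) auto
    also have "\<dots> = 3 ^ CARD('n)" by (simp add: card_PiE)
    finally show ?thesis .
  qed simp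
  have "grid \<delta> ` B \<subseteq> (\<Union>U\<in>\<U>. grid \<delta> ` U)" using \<U>(3) by blast
  then have "card (grid \<delta> ` B) \<le> card (\<Union>U\<in>\<U>. grid \<delta> ` U)"
    using \<U> \<delta> by (intro card_mono) (auto intro: finite_grid_image)
  also have "\<dots> \<le> (\<Sum>U\<in>\<U>. card (grid \<delta> ` U))" by (rule card_UN_le[OF \<U>(1)])
  also have "\<dots> \<le> (\<Sum>U\<in>\<U>. 3 ^ CARD('n))" by (intro sum_mono small)
  finally show ?thesis using \<U>(2) by (simp add: mult.commute)
qed

section \<open>Transfer of skeleta to the grid, and the covering estimate\<close>

lemma finite_thicken: "finite S \<Longrightarrow> finite (thicken S :: ('n::finite \<Rightarrow> int) set)"
  by (auto simp: thicken_def intro!: finite_PiE)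

lemma card_thicken_le:
  fixes S :: "('n::finite \<Rightarrow> int) set"
  assumes "finite S"
  shows "card (thicken S) \<le> 3 ^ CARD('n) * card S"
proof -
  have "card (thicken S) \<le> (\<Sum>s\<in>S. card (PiE UNIV (\<lambda>i. {s i - 1..s i + 1})))"
    unfolding thicken_def by (rule card_UN_le[OF assms])
  also have "\<dots> = 3 ^ CARD('n) * card S" by (simp add: card_PiE)
  finally show ?thesis .
qed

text \<open>Every discrete skeleton point is matched with a true one. In the directions of
  \<open>I\<close> the shift is a multiple of \<open>\<delta>\<close> and hits the right cell
  exactly; in the others it is \<open>r\<close> or \<open>- r\<close>, and rounding costs at most
  one cell.\<close>

lemma discrete_skeleton_subset_thicken:
  fixes x :: "real ^ 'n"
  assumes \<delta>: "\<delta> > 0" and r: "r > 0" and sub: "skeleton k x r \<subseteq> B"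
  shows "discrete_skeleton k (grid \<delta> x) \<lfloor>r / \<delta>\<rfloor> \<subseteq> thicken (grid \<delta> ` B)"
proof
  fix b assume "b \<in> discrete_skeleton k (grid \<delta> x) \<lfloor>r / \<delta>\<rfloor>"
  then obtain I where I: "card I = k"
    and b: "\<And>i. if i \<in> I then \<bar>b i - grid \<delta> x i\<bar> \<le> \<lfloor>r / \<delta>\<rfloor> else \<bar>b i - grid \<delta> x i\<bar> = \<lfloor>r / \<delta>\<rfloor>"
    by (auto simp: discrete_skeleton_def)
  define y :: "real ^ 'n" where
    "y = (\<chi> i. if i \<in> I then \<delta> * of_int (b i - grid \<delta> x i)
      else if grid \<delta> x i \<le> b i then r else - r)"
  have "y $ i \<in> {-r..r}" if "i \<in> I" for i
  proof -
    have "\<bar>b i - grid \<delta> x i\<bar> \<le> \<lfloor>r / \<delta>\<rfloor>" using b[of i] that by simp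
    then have "of_int \<bar>b i - grid \<delta> x i\<bar> \<le> r / \<delta>" by (simp add: le_floor_iff)
    then have "\<delta> * \<bar>of_int (b i - grid \<delta> x i)\<bar> \<le> r" using \<delta> by (simp add: field_simps)
    then have "\<bar>y $ i\<bar> \<le> r" using that \<delta> by (simp add: y_def abs_mult)
    then show ?thesis by auto
  qed
  moreover have "y $ i \<in> {-r, r}" if "i \<notin> I" for i using that by (simp add: y_def)
  ultimately have "x + y \<in> skeleton k x r" using I by (auto simp: skeleton_def)
  then have "grid \<delta> (x + y) \<in> grid \<delta> ` B" using sub by blast
  moreover have "\<bar>b i - grid \<delta> (x + y) i\<bar> \<le> 1" for i
  proof (cases "i \<in> I")
    case True
    then have "(x + y) $ i / \<delta> = x $ i / \<delta> + of_int (b i - grid \<delta> x i)"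
      using \<delta> by (simp add: y_def add_divide_distrib)
    then show ?thesis by (simp add: grid_def)
  next
    case False
    then have eq: "\<bar>b i - \<lfloor>x $ i / \<delta>\<rfloor>\<bar> = \<lfloor>r / \<delta>\<rfloor>" using b[of i] by (simp add: grid_def)
    have "(x + y) $ i / \<delta> = x $ i / \<delta> + (if \<lfloor>x $ i / \<delta>\<rfloor> \<le> b i then r / \<delta> else - (r / \<delta>))"
      using False by (simp add: y_def grid_def add_divide_distrib)
    then show ?thesis using eq unfolding grid_def by (auto split: if_splits) linarith+
  qed
  then have "b \<in> PiE UNIV (\<lambda>i. {grid \<delta> (x + y) i - 1..grid \<delta> (x + y) i + 1})"
    by (auto simp: abs_le_iff algebra_simps)
  ultimately show "b \<in> thicken (grid \<delta> ` B)" unfolding thicken_def by blast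
qed

text \<open>The two opposite corners in direction (1, ..., 1) lie in \<open>B\<close>, and their
  coordinates differ by \<open>2 * r\<close>.\<close>

lemma skeleton_radius_le:
  fixes x :: "real ^ 'n"
  assumes "k \<le> CARD('n)" and r: "r > 0" and "skeleton k x r \<subseteq> B"
    and M: "\<And>b. b \<in> B \<Longrightarrow> norm b \<le> M"
  shows "r \<le> M"
proof -
  obtain I :: "'n set" where I: "card I = k" using assms(1) by (metis obtain_subset_with_card_n)
  have corner: "x + (\<chi> i. s) \<in> skeleton k x r" if "s = r \<or> s = - r" for s
  proof -
    have "(\<chi> i. s) \<in> {y. \<forall>i. y $ i \<in> (if i \<in> I then {- r..r} else {- r, r})}"
      using r that by auto
    then show ?thesis unfolding skeleton_def using I by blast
  qed
  define i :: 'n where "i = undefined"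
  have "\<bar>(x + (\<chi> i. r)) $ i\<bar> \<le> M" "\<bar>(x + (\<chi> i. - r)) $ i\<bar> \<le> M"
    using corner[of r] corner[of "- r"] assms(3) M component_le_norm_cart order_trans by blast+
  then show ?thesis by simp
qed

text \<open>In grid units the radii are at most a constant times \<open>1 / \<delta>\<close>, so the
  discrete loss \<open>L powr \<theta>\<close> becomes
  \<open>\<delta> powr (- \<theta>)\<close>.\<close>

lemma covering_number_centres_le:
  fixes A B :: "(real ^ 'n) set"
  assumes k: "k < CARD('n)" and A: "bounded A" and B: "bounded B"
    and skel: "\<forall>x\<in>A. \<exists>r>0. skeleton k x r \<subseteq> B"
    and \<theta>: "\<theta> = real (CARD('n) - k) / (2 * real CARD('n))"
  obtains C where "C > 0" "\<And>\<delta>. 0 < \<delta> \<Longrightarrow> \<delta> \<le> 1 \<Longrightarrow>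
    real (covering_number (real CARD('n) * \<delta>) A) \<le> C * \<delta> powr (- \<theta>) * real (covering_number \<delta> B)"
proof -
  obtain M where M: "M > 0" "\<And>b. b \<in> B \<Longrightarrow> norm b \<le> M" using B bounded_pos by blast
  have \<theta>0: "\<theta> > 0" using k by (simp add: \<theta>)
  define K where "K = 5 ^ CARD('n) / (2 powr \<theta> - 1)"
  have K: "K > 0" using \<theta>0 by (simp add: K_def)
  \<comment> \<open>One power of 3 pays for \<open>thicken\<close>, the other for passing from grid
    cells to covering sets. \<open>M + 2\<close> comes from bounding \<open>L\<close>: both the
    offset 1 and the ceiling are absorbed by \<open>\<delta> \<le> 1\<close>.\<close>
  define C where "C = K * (2 * (M + 2)) powr \<theta> * (3 ^ CARD('n) * 3 ^ CARD('n))"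
  have "real (covering_number (real CARD('n) * \<delta>) A) \<le> C * \<delta> powr (- \<theta>) * real (covering_number \<delta> B)"
    if \<delta>: "0 < \<delta>" "\<delta> \<le> 1" for \<delta>
  proof -
    define L where "L = nat \<lceil>(M + 1) / \<delta>\<rceil>"
    have Lpos: "(M + 1) / \<delta> > 0" using M \<delta> by simp
    then have L: "(M + 1) / \<delta> \<le> real L" "L > 0" by (auto simp: L_def of_nat_ceiling)
    have "real L \<le> (M + 1) / \<delta> + 1" using Lpos by (simp add: L_def)
    also have "\<dots> \<le> (M + 2) / \<delta>" using \<delta> by (simp add: field_simps)
    finally have LM: "real L \<le> (M + 2) / \<delta>" .
    have "\<forall>a\<in>grid \<delta> ` A. \<exists>m. (0 \<le> m \<and> m + 1 \<le> int L) \<and>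
      discrete_skeleton k a m \<subseteq> thicken (grid \<delta> ` B)"
    proof (clarify, goal_cases)
      case (1 _ x)
      then obtain r where r: "r > 0" "skeleton k x r \<subseteq> B" using skel by blast
      have "r \<le> M" using skeleton_radius_le[OF _ r M(2)] k by simp
      then have "r / \<delta> \<le> M / \<delta>" "1 \<le> 1 / \<delta>" using \<delta> by (simp_all add: divide_right_mono)
      then have "r / \<delta> + 1 \<le> (M + 1) / \<delta>" unfolding add_divide_distrib by linarith
      then have "\<lfloor>r / \<delta>\<rfloor> + 1 \<le> int L" using L(1) by linarith
      moreover have "0 \<le> \<lfloor>r / \<delta>\<rfloor>" using r \<delta> by simp
      ultimately show ?case
        using discrete_skeleton_subset_thicken[OF \<delta>(1) r] by blast
    qed
    then obtain m where m: "\<And>a. a \<in> grid \<delta> ` A \<Longrightarrow> 0 \<le> m a \<and> m a + 1 \<le> int L"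
      "\<And>a. a \<in> grid \<delta> ` A \<Longrightarrow> discrete_skeleton k a (m a) \<subseteq> thicken (grid \<delta> ` B)"
      by metis
    have "real (covering_number (real CARD('n) * \<delta>) A) \<le> real (card (grid \<delta> ` A))"
      using covering_number_le_card_grid[OF A \<delta>(1)] by simp
    also have "\<dots> \<le> K * (2 * real L) powr \<theta> * real (card (thicken (grid \<delta> ` B)))"
      unfolding K_def
      by (rule card_discrete_centres[OF _ _ k L(2) m \<theta>])
        (auto intro: finite_thicken finite_grid_image A B \<delta>)
    also have "\<dots> \<le> K * ((2 * (M + 2)) powr \<theta> * \<delta> powr (- \<theta>)) *
        (3 ^ CARD('n) * 3 ^ CARD('n) * real (covering_number \<delta> B))"
    proof (intro mult_mono mult_left_mono)
      have "(2 * real L) powr \<theta> \<le> (2 * ((M + 2) / \<delta>)) powr \<theta>"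
        using LM \<theta>0 by (intro powr_mono2 mult_left_mono) auto
      also have "\<dots> = (2 * (M + 2)) powr \<theta> * \<delta> powr (- \<theta>)"
        using M \<delta> by (simp add: powr_divide powr_minus_divide)
      finally show "(2 * real L) powr \<theta> \<le> (2 * (M + 2)) powr \<theta> * \<delta> powr (- \<theta>)" .
      have "card (thicken (grid \<delta> ` B)) \<le> 3 ^ CARD('n) * card (grid \<delta> ` B)"
        by (intro card_thicken_le finite_grid_image B \<delta>)
      also have "\<dots> \<le> 3 ^ CARD('n) * (3 ^ CARD('n) * covering_number \<delta> B)"
        by (intro mult_left_mono card_grid_le_covering_number B \<delta>) auto
      finally have "real (card (thicken (grid \<delta> ` B)))
          \<le> real (3 ^ CARD('n) * (3 ^ CARD('n) * covering_number \<delta> B))"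
        by (simp only: of_nat_le_iff)
      then show "real (card (thicken (grid \<delta> ` B)))
          \<le> 3 ^ CARD('n) * 3 ^ CARD('n) * real (covering_number \<delta> B)"
        by simp
    qed (use K in auto)
    finally show ?thesis by (simp add: C_def mult_ac)
  qed
  moreover have "C > 0" using K M by (simp add: C_def)
  ultimately show ?thesis using that by blast
qed

section \<open>Passage from covering numbers to box dimension\<close>

theorem corollary3p5:
  fixes A B :: "(real ^ 'n) set" and k :: nat
  assumes "k < CARD('n)"
    and "bounded A" and "bounded B"
    and "has_box_dim A (ereal (real CARD('n)))"
    and "\<forall>x\<in>A. \<exists>r>0. skeleton k x r \<subseteq> B"
  shows "lower_box_dim B \<ge> ereal (real CARD('n) - 1 / 2 + real k / (2 * real CARD('n)))"
proof -
  define n where "n = real CARD('n)"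
  have n: "n \<ge> 1" by (simp add: n_def Suc_le_eq)
  define \<theta> where "\<theta> = real (CARD('n) - k) / (2 * real CARD('n))"
  have \<theta>: "n - \<theta> = n - 1 / 2 + real k / (2 * n)"
    using assms(1) by (simp add: \<theta>_def n_def of_nat_diff field_simps)
  have "real k / (2 * n) \<ge> 0" using n by simp
  with \<theta> n have \<theta>n: "\<theta> < n" by linarith
  obtain C where C: "C > 0" "\<And>\<delta>. 0 < \<delta> \<Longrightarrow> \<delta> \<le> 1 \<Longrightarrow>
    real (covering_number (n * \<delta>) A) \<le> C * \<delta> powr (- \<theta>) * real (covering_number \<delta> B)"
    using covering_number_centres_le[OF assms(1,2,3,5) \<theta>_def] unfolding n_def by metis
  have "ereal z \<le> lower_box_dim B" if z: "z < n - \<theta>" for z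
  proof -
    \<comment> \<open>A value below the dimension \<open>n\<close> of \<open>A\<close> that still
      exceeds \<open>z + \<theta>\<close>. The \<open>max\<close> with 0 makes it positive, which
      later excludes a zero covering number.\<close>
    define s where "s = (max 0 (z + \<theta>) + n) / 2"
    have s: "0 < s" "z + \<theta> < s" "s < n" using z n \<theta>n by (auto simp: s_def max_def field_simps)
    \<comment> \<open>The covering estimate uses scale \<open>n * \<delta>\<close> for
      \<open>A\<close> but \<open>\<delta>\<close> for \<open>B\<close>; the lower bound for
      \<open>A\<close> is therefore pulled back along this map.\<close>
    have scale: "filterlim (\<lambda>\<delta>. n * \<delta>) (at_right 0) (at_right 0)"
      using n by real_asymp
    have "ereal s < lower_box_dim A" using assms(4) s by (simp add: has_box_dim_def n_def)
    then have "\<forall>\<^sub>F \<delta> in at_right 0. ereal s < ereal (ln (real (covering_number \<delta> A)) / - ln \<delta>)"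
      unfolding lower_box_dim_def by (rule less_LiminfD)
    then have evA: "\<forall>\<^sub>F \<delta> in at_right 0. s < ln (real (covering_number (n * \<delta>) A)) / - ln (n * \<delta>)"
      using scale by (auto simp: filterlim_iff)
    \<comment> \<open>The constants \<open>n\<close> and \<open>C\<close> disappear after division
      by \<open>- ln \<delta>\<close>; only the loss \<open>\<theta>\<close> survives.\<close>
    have lim: "((\<lambda>\<delta>. (s * - ln (n * \<delta>) - ln C) / - ln \<delta> - \<theta>) \<longlongrightarrow> s - \<theta>) (at_right 0)"
      using n by real_asymp
    have "\<forall>\<^sub>F \<delta> in at_right 0. z < (s * - ln (n * \<delta>) - ln C) / - ln \<delta> - \<theta>"
      using order_tendstoD(1)[OF lim, of z] s by simp
    moreover have "\<forall>\<^sub>F \<delta> in at_right (0::real). 0 < \<delta> \<and> \<delta> < 1 / n"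
      using n by (auto simp: eventually_at_right_field intro!: exI[of _ "1 / n"])
    ultimately have "\<forall>\<^sub>F \<delta> in at_right 0. ereal z \<le> ereal (ln (real (covering_number \<delta> B)) / - ln \<delta>)"
      using evA
    proof eventually_elim
      case (elim \<delta>)
      have nd: "0 < n * \<delta>" "n * \<delta> < 1" using elim n by (auto simp: field_simps)
      moreover have "1 * \<delta> \<le> n * \<delta>" using elim n by (intro mult_right_mono) auto
      ultimately have "\<delta> < 1" by linarith
      with nd have neg: "ln (n * \<delta>) < 0" "ln \<delta> < 0" using elim by simp_all
      define a where "a = real (covering_number (n * \<delta>) A)"
      define b where "b = real (covering_number \<delta> B)"
      have "s * - ln (n * \<delta>) < ln a" using elim neg by (simp add: a_def field_simps)
      then have a: "s * - ln (n * \<delta>) < ln a" "ln a > 0"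
        using s neg mult_pos_neg[of s "ln (n * \<delta>)"] by auto
      \<comment> \<open>Since \<open>ln 0 = 0\<close>, positivity of \<open>ln a\<close> rules out
        \<open>a = 0\<close>; the covering estimate then forces \<open>b > 0\<close> as
        well.\<close>
      then have apos: "a > 0" by (cases "a = 0") (auto simp: a_def)
      have ab: "a \<le> C * \<delta> powr (- \<theta>) * b" unfolding a_def b_def using C elim \<open>\<delta> < 1\<close> by auto
      then have bpos: "b > 0" using apos by (auto simp: b_def intro: gr0I)
      have "ln a \<le> ln (C * \<delta> powr (- \<theta>) * b)" using ab apos by simp
      also have "\<dots> = ln C - \<theta> * ln \<delta> + ln b"
        using C bpos elim by (simp add: ln_mult ln_powr)
      finally have "s * - ln (n * \<delta>) - ln C + \<theta> * ln \<delta> \<le> ln b" using a by linarith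
      then have "(s * - ln (n * \<delta>) - ln C + \<theta> * ln \<delta>) / - ln \<delta> \<le> ln b / - ln \<delta>"
        using neg by (intro divide_right_mono) auto
      also have "(s * - ln (n * \<delta>) - ln C + \<theta> * ln \<delta>) / - ln \<delta> =
          (s * - ln (n * \<delta>) - ln C) / - ln \<delta> - \<theta>"
        using neg by (simp add: field_simps)
      finally show ?case using elim by (simp add: b_def)
    qed
    then show ?thesis unfolding lower_box_dim_def by (rule Liminf_bounded)
  qed
  then have "y \<le> lower_box_dim B" if "y < ereal (n - \<theta>)" for y
    using that by (cases y) auto
  then have "ereal (n - \<theta>) \<le> lower_box_dim B" by (rule dense_le)
  then show ?thesis unfolding \<theta> by (simp only: n_def)
qed

end
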